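(* Let $n,m$ be positive integers with $m \ge n$, and let $P_n \Box P_m$ be the Cartesian product of the paths on $n$ and $m$ vertices (the $n\times m$ grid graph). Then \[Z_{(1)}(P_n \Box P_m) \le 2m-n.\]
   Context: Let $G=(V,E)$ be a finite simple graph. Color-change rule (zero forcing): given a set of colored vertices, a colored vertex with exactly one uncolored neighbor colors ("forces") that neighbor. Leaks: for a set $L\subseteq V$, placing a leak on each $v\in L$ means attaching to $v$ one new pendant vertex (adjacent only to $v$) which is never initially colored; consequently no vertex of $L$ can ever force a vertex of $V$. A set $S\subseteq V$ is an $\ell$-forcing set if for every $L\subseteq V$ with $|L|\le \ell$, starting with exactly the vertices of $S$ colored and repeatedly applying the color-change rule in the graph with leaks on $L$, every vertex of $V$ eventually becomes colored. The $\ell$-forcing number $Z_{(\ell)}(G)$ ($\ell\ge 0$ an integer) is the minimum size of an $\ell$-forcing set; $Z_{(0)}(G)$ is the usual zero forcing number. The Cartesian product $G\Box H$ has vertex set $V(G)\times V(H)$, with $(x,y)\sim(x',y')$ iff ($x=x'$ and $y\sim y'$ in $H$) or ($y=y'$ and $x\sim x'$ in $G$). *)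

theory Defs
  imports Main
begin

record 'a sgraph =
  verts :: "'a set"
  adj :: "'a \<Rightarrow> 'a \<Rightarrow> bool"

definition simple_graph :: "'a sgraph \<Rightarrow> bool" where
  "simple_graph G \<longleftrightarrow> finite (verts G) \<and>
     (\<forall>u v. adj G u v \<longrightarrow> u \<in> verts G \<and> v \<in> verts G) \<and>
     (\<forall>u v. adj G u v \<longrightarrow> adj G v u) \<and>
     (\<forall>v. \<not> adj G v v)"

definition path_graph :: "nat \<Rightarrow> nat sgraph" where
  "path_graph n =
     \<lparr>verts = {0..<n},
      adj = (\<lambda>i j. i < n \<and> j < n \<and> (j = Suc i \<or> i = Suc j))\<rparr>"

definition cartesian_product :: "'a sgraph \<Rightarrow> 'b sgraph \<Rightarrow> ('a \<times> 'b) sgraph"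
    (infixr "\<box>" 80) where
  "G \<box> H =
     \<lparr>verts = verts G \<times> verts H,
      adj = (\<lambda>p q. p \<in> verts G \<times> verts H \<and> q \<in> verts G \<times> verts H \<and>
               (fst p = fst q \<and> adj H (snd p) (snd q) \<or>
                snd p = snd q \<and> adj G (fst p) (fst q)))\<rparr>"

inductive color_change :: "'a sgraph \<Rightarrow> 'a set \<Rightarrow> 'a set \<Rightarrow> bool" for G where
  force: "\<lbrakk>u \<in> B; {x. adj G u x \<and> x \<notin> B} = {w}\<rbrakk> \<Longrightarrow> color_change G B (insert w B)"

text \<open>
  Each vertex \<open>v\<close> of \<open>G\<close> becomes \<open>Inl v\<close>; the pendant vertex attached to
  \<open>v \<in> L\<close> is \<open>Inr v\<close>.
\<close>

definition attach_leaks :: "'a sgraph \<Rightarrow> 'a set \<Rightarrow> ('a + 'a) sgraph" where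
  "attach_leaks G L =
     \<lparr>verts = Inl ` verts G \<union> Inr ` L,
      adj = (\<lambda>p q.
        (\<exists>u v. p = Inl u \<and> q = Inl v \<and> adj G u v) \<or>
        (\<exists>v\<in>L. p = Inl v \<and> q = Inr v) \<or>
        (\<exists>v\<in>L. p = Inr v \<and> q = Inl v))\<rparr>"

text \<open>
  The existential over reachable colorings is harmless: the rule only adds colors, and a force
  that is available stays available until its target is colored, so in a finite graph all
  maximal runs end in the same coloring.
\<close>

definition leaky_forcing_set :: "nat \<Rightarrow> 'a sgraph \<Rightarrow> 'a set \<Rightarrow> bool" where
  "leaky_forcing_set l G S \<longleftrightarrow> S \<subseteq> verts G \<and>
     (\<forall>L. L \<subseteq> verts G \<and> card L \<le> l \<longrightarrow>
        (\<exists>B. (color_change (attach_leaks G L))\<^sup>*\<^sup>* (Inl ` S) B \<and> Inl ` verts G \<subseteq> B))"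

definition leaky_forcing_number :: "nat \<Rightarrow> 'a sgraph \<Rightarrow> nat" where
  "leaky_forcing_number l G = (LEAST k. \<exists>S. leaky_forcing_set l G S \<and> card S = k)"

lemma leaky_forcing_set_verts: "leaky_forcing_set l G (verts G)"
  unfolding leaky_forcing_set_def by blast

lemma leaky_forcing_number_attained:
  "\<exists>S. leaky_forcing_set l G S \<and> card S = leaky_forcing_number l G"
  unfolding leaky_forcing_number_def
  by (rule LeastI_ex) (use leaky_forcing_set_verts in blast)

lemma simple_graph_path_graph: "simple_graph (path_graph n)"
  by (auto simp: simple_graph_def path_graph_def)

lemma simple_graph_cartesian_product:
  "\<lbrakk>simple_graph G; simple_graph H\<rbrakk> \<Longrightarrow> simple_graph (G \<box> H)"
  by (auto simp: simple_graph_def cartesian_product_def)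

lemma simple_graph_attach_leaks:
  "\<lbrakk>simple_graph G; L \<subseteq> verts G\<rbrakk> \<Longrightarrow> simple_graph (attach_leaks G L)"
  by (auto simp: simple_graph_def attach_leaks_def intro: finite_subset)

end

theory Submission
  imports Defs
begin

text \<open>
  A set \<open>S\<close> is a 1-forcing set as soon as it has two zero forcing processes in which every vertex
  outside \<open>S\<close> is forced by two different vertices: if a maximal run with one leak got stuck, the
  first uncolored vertices \<open>v\<close> and \<open>w\<close> of the two processes would both have the leak as their
  forcer; since all other neighbours of the forcer of \<open>v\<close> are colored, \<open>v = w\<close>, a contradiction.

  In the grid, take for \<open>S\<close> a slit: a staircase from the corner \<open>(0, 0)\<close> along the diagonal to the
  middle row \<open>n div 2\<close>, followed by a segment of the middle row. The two processes run around the
  slit clockwise and counterclockwise. The grid is cut by diagonals from the corners into a top,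
  right, bottom and left part, in each of which the process just moves straight along rows or
  columns.
\<close>

section \<open>Forcing schedules and a criterion for 1-forcing sets\<close>

text \<open>\<open>f v\<close> is the vertex meant to force \<open>v\<close>, and \<open>t v\<close>
  the time of that force. Vertices of \<open>S\<close> are colored from the start, so their times
  are ignored.\<close>

definition forcing_schedule :: "'a sgraph \<Rightarrow> 'a set \<Rightarrow> ('a \<Rightarrow> 'a) \<Rightarrow> ('a \<Rightarrow> nat) \<Rightarrow> bool" where
  "forcing_schedule G S f t \<longleftrightarrow> (\<forall>v \<in> verts G - S. adj G (f v) v \<and>
     (\<forall>y. (y = f v \<or> adj G (f v) y) \<and> y \<noteq> v \<and> y \<notin> S \<longrightarrow> t y < t v))"

text \<open>Among the finitely many reachable colorings inside \<open>verts G\<close>, one that is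
  maximal under inclusion admits no further force.\<close>

lemma ex_stuck_coloring:
  assumes "finite (verts G)"
      "\<And>u v. adj G u v \<Longrightarrow> v \<in> verts G" "S \<subseteq> verts G"
  obtains B where "(color_change G)\<^sup>*\<^sup>* S B" "S \<subseteq> B"
    "\<And>u w. u \<in> B \<Longrightarrow> {x. adj G u x \<and> x \<notin> B} \<noteq> {w}"
proof -
  let ?R = "{B. (color_change G)\<^sup>*\<^sup>* S B \<and> S \<subseteq> B \<and> B \<subseteq> verts G}"
  have "finite ?R"
    by (rule finite_subset[of _ "Pow (verts G)"]) (use assms in auto)
  moreover have "?R \<noteq> {}"
    using assms by blast
  ultimately obtain B where B: "B \<in> ?R" and max: "\<And>C. C \<in> ?R \<Longrightarrow> B \<subseteq> C \<Longrightarrow> B = C"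
    by (meson finite_has_maximal)
  have "{x. adj G u x \<and> x \<notin> B} \<noteq> {w}" if "u \<in> B" for u w
  proof
    assume eq: "{x. adj G u x \<and> x \<notin> B} = {w}"
    then have w: "adj G u w" "w \<notin> B"
      by blast+
    have "color_change G B (insert w B)"
      using that eq by (rule color_change.force)
    then have "insert w B \<in> ?R"
      using B w assms(2) by (auto intro: rtranclp.rtrancl_into_rtrancl)
    then show False
      using max[of "insert w B"] w by blast
  qed
  then show thesis
    using that B by blast
qed

text \<open>Choose \<open>v\<close> outside \<open>C\<close> of least time: every other vertex in
  the closed neighborhood of \<open>f v\<close> is earlier or in \<open>S\<close>, hence in
  \<open>C\<close>. Since \<open>C\<close> is any superset of \<open>S\<close>, two schedules can be
  compared on the same stuck coloring.\<close>

lemma forcing_schedule_first_uncolored: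
  assumes "forcing_schedule G S f t"
      "simple_graph G" "S \<subseteq> C" "\<not> verts G \<subseteq> C"
  obtains v where "v \<in> verts G" "v \<notin> C" "f v \<in> C" "adj G (f v) v"
    "\<And>y. adj G (f v) y \<Longrightarrow> y \<noteq> v \<Longrightarrow> y \<in> C"
proof -
  obtain v where v: "v \<in> verts G"
      "v \<notin> C" and least: "\<And>y. y \<in> verts G - C \<Longrightarrow> t v \<le> t y"
    using assms(4) exists_least_iff[of "\<lambda>i. \<exists>v \<in> verts G - C. t v = i"]
    by (metis DiffD1 DiffD2 DiffI not_le_imp_less subsetI)
  have sched: "adj G (f v) v"
    "\<And>y. y = f v \<or> adj G (f v) y \<Longrightarrow> y \<noteq> v \<Longrightarrow> y \<notin> S \<Longrightarrow> t y < t v"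
    using v assms(1,3) by (auto simp: forcing_schedule_def)
  have colored: "y \<in> C" if "y = f v \<or> adj G (f v) y" "y \<noteq> v" for y
  proof (rule ccontr)
    assume "y \<notin> C"
    moreover have "y \<in> verts G"
      using that sched(1) assms(2) unfolding simple_graph_def by blast
    ultimately show False
      using sched(2)[of y] least[of y] that assms(3) by fastforce
  qed
  have "f v \<noteq> v"
    using sched(1) assms(2) unfolding simple_graph_def by metis
  then show thesis
    using that v sched(1) colored by blast
qed

lemma leaky_forcing_set_1I:
  assumes G: "simple_graph G" and S: "S \<subseteq> verts G"
    and f: "forcing_schedule G S f t" and g: "forcing_schedule G S g s"
    and neq: "\<And>v. v \<in> verts G - S \<Longrightarrow> f v \<noteq> g v"
  shows "leaky_forcing_set 1 G S"
  unfolding leaky_forcing_set_def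
proof (intro conjI allI impI S)
  fix L assume "L \<subseteq> verts G \<and> card L \<le> 1"
  moreover have "finite (verts G)"
    using G by (simp add: simple_graph_def)
  ultimately have L: "L \<subseteq> verts G"
      "\<And>x y. x \<in> L \<Longrightarrow> y \<in> L \<Longrightarrow> x = y"
    using card_le_Suc0_iff_eq finite_subset by (blast, metis One_nat_def)
  let ?H = "attach_leaks G L"
  have H: "simple_graph ?H"
    using G L(1) by (rule simple_graph_attach_leaks)
  obtain B where B: "(color_change ?H)\<^sup>*\<^sup>* (Inl ` S) B" "Inl ` S \<subseteq> B"
    and stuck: "\<And>u w. u \<in> B \<Longrightarrow> {x. adj ?H u x \<and> x \<notin> B} \<noteq> {w}"
  proof (rule ex_stuck_coloring[of ?H "Inl ` S"])
    show "Inl ` S \<subseteq> verts ?H"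
      using S by (auto simp: attach_leaks_def)
  qed (use H in \<open>auto simp: simple_graph_def\<close>)
  define C where "C = {v. Inl v \<in> B}"
  \<comment> \<open>Without a leak on \<open>u\<close>, its only uncolored neighbor in
    \<open>G\<close> is also its only one in \<open>?H\<close>, and \<open>u\<close> would force it
    although \<open>B\<close> is stuck.\<close>
  have leak: "u \<in> L"
    if "u \<in> C" "adj G u v" "v \<notin> C" "\<And>y. adj G u y \<Longrightarrow> y \<noteq> v \<Longrightarrow> y \<in> C" for u v
  proof (rule ccontr)
    assume "u \<notin> L"
    then have "{x. adj ?H (Inl u) x \<and> x \<notin> B} = {Inl v}"
      using that by (auto simp: attach_leaks_def C_def)
    then show False
      using stuck that(1) by (auto simp: C_def)
  qed
  have SC: "S \<subseteq> C"
    using B by (auto simp: C_def)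
  have "verts G \<subseteq> C"
  proof (rule ccontr)
    assume nsub: "\<not> verts G \<subseteq> C"
    obtain v where v: "v \<in> verts G" "v \<notin> C" "f v \<in> C" "adj G (f v) v"
      "\<And>y. adj G (f v) y \<Longrightarrow> y \<noteq> v \<Longrightarrow> y \<in> C"
      using forcing_schedule_first_uncolored[OF f G SC nsub] by blast
    obtain w where w: "w \<in> verts G" "w \<notin> C" "g w \<in> C" "adj G (g w) w"
      "\<And>y. adj G (g w) y \<Longrightarrow> y \<noteq> w \<Longrightarrow> y \<in> C"
      using forcing_schedule_first_uncolored[OF g G SC nsub] by blast
    have eq: "f v = g w"
      using L(2)[OF leak[OF v(3,4,2,5)] leak[OF w(3,4,2,5)]] .
    then have "v = w"
      using v(5)[of w] w(2,4) by auto
    then show False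
      using eq neq[of v] v(1,2) SC by blast
  qed
  then show "\<exists>B. (color_change ?H)\<^sup>*\<^sup>* (Inl ` S) B \<and> Inl ` verts G \<subseteq> B"
    using B(1) by (auto simp: C_def)
qed

section \<open>The slit and the two processes around it\<close>

text \<open>
  For even \<open>n\<close>, the extra vertex above the right end of the middle segment lets the counterclockwise
  process get around that end.
\<close>

definition slit :: "nat \<Rightarrow> nat \<Rightarrow> (nat \<times> nat) set" where
  "slit n m = {(r, c). r < n \<and> c < m \<and> (let k = n div 2 in
     r < k \<and> r = c \<or>
     r < k \<and> r = Suc c \<or>
     r = k \<and> k \<le> Suc c \<and> r + c < m \<or>
     n = 2 * k \<and> Suc r = k \<and> r + c + 2 = m)}"

text \<open>
  The branches are the top, right, bottom and left part of the grid. The diagonal separating two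
  parts belongs to the part that is processed first, so the two schedules split the grid
  differently.
\<close>

definition cw_forcer :: "nat \<Rightarrow> nat \<Rightarrow> nat \<times> nat \<Rightarrow> nat \<times> nat" where
  "cw_forcer n m = (\<lambda>(r, c).
     if r < n div 2 \<and> r < c \<and> r + c < m then (r, c - 1)
     else if m \<le> r + c \<and> m + r \<le> c + n then (r - 1, c)
     else if n div 2 < r \<and> n \<le> Suc (r + c) then (r, c + 1)
     else (r + 1, c))"

text \<open>The offsets place the four phases in disjoint ranges, in the order of the branches.
  Within a phase the time is the coordinate along the direction of motion, subtracted when that
  coordinate decreases. The same holds for \<open>ccw_time\<close>.\<close>

definition cw_time :: "nat \<Rightarrow> nat \<Rightarrow> nat \<times> nat \<Rightarrow> nat" where
  "cw_time n m = (\<lambda>(r, c).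
     if r < n div 2 \<and> r < c \<and> r + c < m then c
     else if m \<le> r + c \<and> m + r \<le> c + n then (n + m) + r
     else if n div 2 < r \<and> n \<le> Suc (r + c) then 3 * (n + m) - c
     else 5 * (n + m) - r)"

definition ccw_forcer :: "nat \<Rightarrow> nat \<Rightarrow> nat \<times> nat \<Rightarrow> nat \<times> nat" where
  "ccw_forcer n m = (\<lambda>(r, c).
     if c + 2 \<le> r \<and> r + c < n then (r - 1, c)
     else if n div 2 \<le> r \<and> c + n \<le> m + r then (r, c - 1)
     else if m \<le> Suc (r + c) then (r + 1, c)
     else (r, c + 1))"

definition ccw_time :: "nat \<Rightarrow> nat \<Rightarrow> nat \<times> nat \<Rightarrow> nat" where
  "ccw_time n m = (\<lambda>(r, c).
     if c + 2 \<le> r \<and> r + c < n then r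
     else if n div 2 \<le> r \<and> c + n \<le> m + r then (n + m) + c
     else if m \<le> Suc (r + c) then 3 * (n + m) - r
     else 5 * (n + m) - c)"

section \<open>The grid in coordinates\<close>

lemma verts_grid: "verts (path_graph n \<box> path_graph m) = {0..<n} \<times> {0..<m}"
  by (simp add: path_graph_def cartesian_product_def)

lemma adj_grid:
  "adj (path_graph n \<box> path_graph m) (r, c) (r', c') \<longleftrightarrow>
     r < n \<and> r' < n \<and> c < m \<and> c' < m \<and>
     (r = r' \<and> (c' = Suc c \<or> c = Suc c') \<or> c = c' \<and> (r' = Suc r \<or> r = Suc r'))"
  by (auto simp: path_graph_def cartesian_product_def)

lemma grid_forcing_scheduleI:
  assumes "\<And>r c. r < n \<Longrightarrow> c < m \<Longrightarrow> (r, c) \<notin> S \<Longrightarrow>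
      adj (path_graph n \<box> path_graph m) (f (r, c)) (r, c)"
    and "\<And>r c r' c'. r < n \<Longrightarrow> c < m \<Longrightarrow> (r, c) \<notin> S \<Longrightarrow> r' < n \<Longrightarrow> c' < m \<Longrightarrow> (r', c') \<notin> S \<Longrightarrow>
      (r', c') \<noteq> (r, c) \<Longrightarrow>
      (r', c') = f (r, c) \<or> adj (path_graph n \<box> path_graph m) (f (r, c)) (r', c') \<Longrightarrow>
      t (r', c') < t (r, c)"
  shows "forcing_schedule (path_graph n \<box> path_graph m) S f t"
proof -
  let ?G = "path_graph n \<box> path_graph m"
  have adjV: "adj ?G u v \<Longrightarrow> u \<in> {0..<n} \<times> {0..<m} \<and> v \<in> {0..<n} \<times> {0..<m}" for u v
    by (simp add: path_graph_def cartesian_product_def)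
  show ?thesis
    unfolding forcing_schedule_def verts_grid
  proof (intro ballI conjI allI impI)
    fix v assume v: "v \<in> {0..<n} \<times> {0..<m} - S"
    then show *: "adj ?G (f v) v"
      using assms(1) by auto
    fix y assume y: "(y = f v \<or> adj ?G (f v) y) \<and> y \<noteq> v \<and> y \<notin> S"
    then have "y \<in> {0..<n} \<times> {0..<m}"
      using adjV * by blast
    then show "t y < t v"
      using assms(2)[of "fst v" "snd v" "fst y" "snd y"] v y by (cases y) auto
  qed
qed

lemma closed_nbhd_grid:
  assumes "(r', c') = (r, c) \<or> adj (path_graph n \<box> path_graph m) (r, c) (r', c')"
  shows "r' = r \<and> c' = c \<or> r' = r \<and> c' = Suc c \<or> r' = r \<and> Suc c' = c \<or>
     r' = Suc r \<and> c' = c \<or> Suc r' = r \<and> c' = c"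
  using assms unfolding adj_grid by auto

lemma not_in_slitD:
  assumes "(r, c) \<notin> slit n m" "r < n" "c < m"
  shows "\<not> (r < n div 2 \<and> r = c)" "\<not> (r < n div 2 \<and> r = Suc c)"
    "\<not> (r = n div 2 \<and> n div 2 \<le> Suc c \<and> r + c < m)"
    "\<not> (n = 2 * (n div 2) \<and> Suc r = n div 2 \<and> r + c + 2 = m)"
  using assms by (simp_all add: slit_def Let_def)

text \<open>The last branch of \<open>cw_forcer\<close> is only a remainder. Off the slit, it is the
  region below the staircase and strictly above the antidiagonal from the bottom left corner. Hence
  the counterclockwise process also treats it as left, and it misses the last row.\<close>

lemma left_part:
  assumes nm: "n \<le> m" and v: "(r, c) \<notin> slit n m" "r < n" "c < m"
    and nt: "\<not> (r < n div 2 \<and> r < c \<and> r + c < m)"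
    and nr: "\<not> (m \<le> r + c \<and> m + r \<le> c + n)"
    and nb: "\<not> (n div 2 < r \<and> n \<le> Suc (r + c))"
  shows "c + 2 \<le> r" "Suc (r + c) < n"
proof -
  obtain k where k: "n div 2 = k"
    by blast
  then have half: "2 * k \<le> n" "n \<le> Suc (2 * k)"
    by presburger+
  note v' = not_in_slitD[OF v, unfolded k]
  consider "r < k" | "r = k" | "k < r"
    by linarith
  then have "c + 2 \<le> r \<and> Suc (r + c) < n"
  proof cases
    case 1
    then show ?thesis
      using nt nr half nm v' v(2,3) unfolding k by linarith
  next
    case 2
    then show ?thesis
      using nr half nm v'(3) v(2,3) unfolding k by linarith
  next
    case 3
    then show ?thesis
      using nb half unfolding k by linarith
  qed
  then show "c + 2 \<le> r" "Suc (r + c) < n"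
    by simp_all
qed

section \<open>Verification of the two schedules\<close>

text \<open>Apart from the target, the neighbors of a forcer lie behind or beside it. Those that
  leave the current part fall into the slit or into a part processed earlier.\<close>

lemma forcing_schedule_cw:
  assumes nm: "n \<le> m"
  shows "forcing_schedule (path_graph n \<box> path_graph m) (slit n m) (cw_forcer n m) (cw_time n m)"
proof (rule grid_forcing_scheduleI)
  fix r c assume v: "r < n" "c < m" "(r, c) \<notin> slit n m"
  obtain k where k: "n div 2 = k"
    by blast
  then have half: "2 * k \<le> n" "n \<le> Suc (2 * k)"
    by presburger+
  \<comment> \<open>Below row \<open>k\<close>, the last column belongs to the right part.\<close>
  have inside1: "Suc c < m"
    if "\<not> (m \<le> r + c \<and> m + r \<le> c + n)" "k < r \<and> n \<le> Suc (r + c)"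
    using that half v(1) by linarith
  have inside2: "Suc r < n"
    if "\<not> (r < k \<and> r < c \<and> r + c < m)" "\<not> (m \<le> r + c \<and> m + r \<le> c + n)"
      "\<not> (k < r \<and> n \<le> Suc (r + c))"
    using left_part[OF nm v(3,1,2)] that k by simp
  show "adj (path_graph n \<box> path_graph m) (cw_forcer n m (r, c)) (r, c)"
    using v(1,2) inside1 inside2 by (auto simp: cw_forcer_def adj_grid k)
next
  fix r c r' c'
  assume v: "r < n" "c < m" "(r, c) \<notin> slit n m"
    and y: "r' < n" "c' < m" "(r', c') \<notin> slit n m" "(r', c') \<noteq> (r, c)"
    and nbhd: "(r', c') = cw_forcer n m (r, c) \<or>
      adj (path_graph n \<box> path_graph m) (cw_forcer n m (r, c)) (r', c')"
  obtain k where k: "n div 2 = k"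
    by blast
  then have half: "2 * k \<le> n" "n \<le> Suc (2 * k)"
    by presburger+
  note y' = not_in_slitD[OF y(3,1,2), unfolded k]
  consider (top) "r < k \<and> r < c \<and> r + c < m"
    | (right) "\<not> (r < k \<and> r < c \<and> r + c < m)"
      "m \<le> r + c \<and> m + r \<le> c + n"
    | (bottom) "\<not> (r < k \<and> r < c \<and> r + c < m)"
      "\<not> (m \<le> r + c \<and> m + r \<le> c + n)" "k < r \<and> n \<le> Suc (r + c)"
    | (left) "\<not> (r < k \<and> r < c \<and> r + c < m)"
      "\<not> (m \<le> r + c \<and> m + r \<le> c + n)" "\<not> (k < r \<and> n \<le> Suc (r + c))"
    by blast
  then show "cw_time n m (r', c') < cw_time n m (r, c)"
  proof cases
    case top
    then obtain b where b: "c = Suc b"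
      using v by (cases c) auto
    have f: "cw_forcer n m (r, c) = (r, b)"
      using top b by (auto simp: cw_forcer_def k)
    have "r' = r \<and> c' = b \<or> r' = r \<and> Suc c' = b \<or>
      r' = Suc r \<and> c' = b \<or> Suc r' = r \<and> c' = b"
      using closed_nbhd_grid[OF nbhd[unfolded f]] y(4) unfolding b by auto
    \<comment> \<open>Neighbors that would leave the top part lie on one of the two diagonals of the
      staircase or in the middle segment.\<close>
    then have "r' < k \<and> r' < c' \<and> r' + c' < m \<and> c' < c"
      using top half nm y'(1-3) unfolding b by (elim disjE; simp; linarith)
    then show ?thesis
      using top v(1,2) y(1,2) by (auto simp: cw_time_def k)
  next
    case right
    then obtain a where a: "r = Suc a"
      using v by (cases r) auto
    have f: "cw_forcer n m (r, c) = (a, c)"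
      using right a by (auto simp: cw_forcer_def k)
    have "r' = a \<and> c' = c \<or> r' = a \<and> c' = Suc c \<or>
      r' = a \<and> Suc c' = c \<or> Suc r' = a \<and> c' = c"
      using closed_nbhd_grid[OF nbhd[unfolded f]] y(4) unfolding a by auto
    then have "(r' < k \<and> r' < c' \<and> r' + c' < m \<or> m \<le> r' + c' \<and> m + r' \<le> c' + n) \<and> r' < r"
      using right(2) half nm v(1,2) y'(1,3) unfolding a by (elim disjE; simp; linarith)
    then show ?thesis
      using right v(1,2) y(1,2) by (auto simp: cw_time_def k)
  next
    case bottom
    then have f: "cw_forcer n m (r, c) = (r, Suc c)"
      by (auto simp: cw_forcer_def k)
    \<comment> \<open>Otherwise \<open>k < r\<close> would give \<open>m \<le> r + c\<close>, and
      the vertex would be in the right part.\<close>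
    have below: "c + n < m + r"
      using bottom(2,3) half by linarith
    have "r' = r \<and> c' = Suc c \<or> r' = r \<and> c' = Suc (Suc c) \<or>
      r' = Suc r \<and> c' = Suc c \<or> Suc r' = r \<and> c' = Suc c"
      using closed_nbhd_grid[OF nbhd[unfolded f]] y(4) by auto
    then have "(m \<le> r' + c' \<and> m + r' \<le> c' + n \<or> k < r' \<and> n \<le> Suc (r' + c')) \<and> c < c'"
      using bottom(3) below half y'(3) by (elim disjE; simp; linarith)
    then show ?thesis
      using bottom v(1,2) y(1,2) by (auto simp: cw_time_def k)
  next
    case left
    then have f: "cw_forcer n m (r, c) = (Suc r, c)"
      by (auto simp: cw_forcer_def k)
    have "r' = Suc r \<and> c' = c \<or> r' = Suc r \<and> c' = Suc c \<or>
      r' = Suc r \<and> Suc c' = c \<or> r' = Suc (Suc r) \<and> c' = c"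
      using closed_nbhd_grid[OF nbhd[unfolded f]] y(4) by auto
    \<comment> \<open>This suffices: the left part comes last, and its lower rows come
      first.\<close>
    then have "r < r'"
      using left by (elim disjE; simp; linarith)
    then show ?thesis
      using left v(1,2) y(1,2) by (auto simp: cw_time_def k)
  qed
qed

lemma forcing_schedule_ccw:
  assumes nm: "n \<le> m"
  shows "forcing_schedule (path_graph n \<box> path_graph m) (slit n m) (ccw_forcer n m) (ccw_time n m)"
proof (rule grid_forcing_scheduleI)
  fix r c assume v: "r < n" "c < m" "(r, c) \<notin> slit n m"
  obtain k where k: "n div 2 = k"
    by blast
  then have half: "2 * k \<le> n" "n \<le> Suc (2 * k)"
    by presburger+
  note v' = not_in_slitD[OF v(3,1,2), unfolded k]
  \<comment> \<open>In column \<open>0\<close>, a vertex outside the left part has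
    \<open>r \<le> 1\<close>; together with \<open>k \<le> r\<close> this puts it in the middle
    segment.\<close>
  have inside1: "0 < c"
    if "\<not> (c + 2 \<le> r \<and> r + c < n)" "k \<le> r \<and> c + n \<le> m + r"
    using that half nm v v' by linarith
  have inside2: "Suc r < n" if "\<not> (k \<le> r \<and> c + n \<le> m + r)" "m \<le> Suc (r + c)"
    using that half nm v by linarith
  show "adj (path_graph n \<box> path_graph m) (ccw_forcer n m (r, c)) (r, c)"
    using v(1,2) inside1 inside2 by (auto simp: ccw_forcer_def adj_grid k)
next
  fix r c r' c'
  assume v: "r < n" "c < m" "(r, c) \<notin> slit n m"
    and y: "r' < n" "c' < m" "(r', c') \<notin> slit n m" "(r', c') \<noteq> (r, c)"
    and nbhd: "(r', c') = ccw_forcer n m (r, c) \<or>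
      adj (path_graph n \<box> path_graph m) (ccw_forcer n m (r, c)) (r', c')"
  obtain k where k: "n div 2 = k"
    by blast
  then have half: "2 * k \<le> n" "n \<le> Suc (2 * k)"
    by presburger+
  note v' = not_in_slitD[OF v(3,1,2), unfolded k]
    and y' = not_in_slitD[OF y(3,1,2), unfolded k]
  consider (left) "c + 2 \<le> r \<and> r + c < n"
    | (bottom) "\<not> (c + 2 \<le> r \<and> r + c < n)" "k \<le> r \<and> c + n \<le> m + r"
    | (right) "\<not> (c + 2 \<le> r \<and> r + c < n)"
      "\<not> (k \<le> r \<and> c + n \<le> m + r)" "m \<le> Suc (r + c)"
    | (top) "\<not> (c + 2 \<le> r \<and> r + c < n)"
      "\<not> (k \<le> r \<and> c + n \<le> m + r)" "\<not> (m \<le> Suc (r + c))"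
    by blast
  then show "ccw_time n m (r', c') < ccw_time n m (r, c)"
  proof cases
    case left
    then obtain a where a: "r = Suc a"
      using v by (cases r) auto
    have f: "ccw_forcer n m (r, c) = (a, c)"
      using left a by (auto simp: ccw_forcer_def k)
    have "r' = a \<and> c' = c \<or> r' = a \<and> c' = Suc c \<or>
      r' = a \<and> Suc c' = c \<or> Suc r' = a \<and> c' = c"
      using closed_nbhd_grid[OF nbhd[unfolded f]] y(4) unfolding a by auto
    then have "c' + 2 \<le> r' \<and> r' + c' < n \<and> r' < r"
      using left half nm y'(1-3) unfolding a by (elim disjE; simp; linarith)
    then show ?thesis
      using left v(1,2) y(1,2) by (auto simp: ccw_time_def k)
  next
    case bottom
    then have "0 < c"
      using half nm v v' by linarith
    then obtain b where b: "c = Suc b"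
      by (cases c) auto
    have f: "ccw_forcer n m (r, c) = (r, b)"
      using bottom b by (auto simp: ccw_forcer_def k)
    \<comment> \<open>In row \<open>k\<close>, vertices left of the middle segment belong to the
      left part, so only those beyond its right end remain.\<close>
    have below: "k < r \<or> m \<le> r + c"
      using bottom half nm v'(3) by linarith
    have "r' = r \<and> c' = b \<or> r' = r \<and> Suc c' = b \<or>
      r' = Suc r \<and> c' = b \<or> Suc r' = r \<and> c' = b"
      using closed_nbhd_grid[OF nbhd[unfolded f]] y(4) unfolding b by auto
    \<comment> \<open>Row \<open>k\<close> meets this case only for \<open>n = 2 * k\<close> and
      \<open>c = m - k\<close>. The vertex above the forcer is then the extra vertex of the slit,
      excluded by \<open>y'(4)\<close>.\<close>
    then have "k \<le> r' \<and> c' + n \<le> m + r' \<and> c' < c"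
      using bottom(2) below half y'(4) unfolding b by (elim disjE; simp; linarith)
    then show ?thesis
      using bottom v(1,2) y(1,2) by (auto simp: ccw_time_def k)
  next
    case right
    then have f: "ccw_forcer n m (r, c) = (Suc r, c)"
      by (auto simp: ccw_forcer_def k)
    have "r' = Suc r \<and> c' = c \<or> r' = Suc r \<and> c' = Suc c \<or>
      r' = Suc r \<and> Suc c' = c \<or> r' = Suc (Suc r) \<and> c' = c"
      using closed_nbhd_grid[OF nbhd[unfolded f]] y(4) by auto
    then have "m \<le> Suc (r' + c') \<and> r < r'"
      using right(3) by (elim disjE; simp; linarith)
    then show ?thesis
      using right v(1,2) y(1,2) by (auto simp: ccw_time_def k)
  next
    case top
    then have f: "ccw_forcer n m (r, c) = (r, Suc c)"
      by (auto simp: ccw_forcer_def k)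
    have "r' = r \<and> c' = Suc c \<or> r' = r \<and> c' = Suc (Suc c) \<or>
      r' = Suc r \<and> c' = Suc c \<or> Suc r' = r \<and> c' = Suc c"
      using closed_nbhd_grid[OF nbhd[unfolded f]] y(4) by auto
    then have "c < c'"
      using top by (elim disjE; simp; linarith)
    then show ?thesis
      using top v(1,2) y(1,2) by (auto simp: ccw_time_def k)
  qed
qed

section \<open>The slit is a 1-forcing set of the required size\<close>

text \<open>Within a common part the processes move in opposite directions. Off the slit, their
  parts differ only on the dividing diagonals, where one forcer lies in the row of the vertex and
  the other in its column.\<close>

lemma cw_forcer_neq_ccw_forcer:
  assumes nm: "n \<le> m" and v: "r < n" "c < m" "(r, c) \<notin> slit n m"
  shows "cw_forcer n m (r, c) \<noteq> ccw_forcer n m (r, c)"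
proof -
  obtain k where k: "n div 2 = k"
    by blast
  then have half: "2 * k \<le> n" "n \<le> Suc (2 * k)"
    by presburger+
  show ?thesis
    using left_part[OF nm v(3,1,2)] nm v(1,2) half unfolding cw_forcer_def ccw_forcer_def k
    by (auto split: if_splits)
qed

lemma leaky_forcing_set_slit:
  assumes "n \<le> m"
  shows "leaky_forcing_set 1 (path_graph n \<box> path_graph m) (slit n m)"
proof (rule leaky_forcing_set_1I)
  show "simple_graph (path_graph n \<box> path_graph m)"
    by (intro simple_graph_cartesian_product simple_graph_path_graph)
  show "slit n m \<subseteq> verts (path_graph n \<box> path_graph m)"
    by (auto simp: verts_grid slit_def)
  show "cw_forcer n m v \<noteq> ccw_forcer n m v"
    if "v \<in> verts (path_graph n \<box> path_graph m) - slit n m" for v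
    using that cw_forcer_neq_ccw_forcer[OF assms, of "fst v" "snd v"]
    by (simp add: verts_grid mem_Times_iff)
qed (rule forcing_schedule_cw[OF assms] forcing_schedule_ccw[OF assms])+

text \<open>Staircase and middle segment have at most \<open>m\<close> vertices together. The extra
  vertex adds one only if \<open>n < m\<close>, and then
  \<open>m + 1 \<le> 2 * m - n\<close>.\<close>

lemma card_slit_le:
  assumes "0 < n" "n \<le> m"
  shows "card (slit n m) \<le> 2 * m - n"
proof -
  define k where "k = n div 2"
  have k: "2 * k \<le> n" "n \<le> Suc (2 * k)"
    by (auto simp: k_def)
  let ?A = "(\<lambda>i. (i, i)) ` {..<k}"
  \<comment> \<open>The range ends at \<open>k - 1\<close> because the corner
    \<open>(k, k - 1)\<close> is counted in \<open>?C\<close>.\<close>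
  let ?B = "(\<lambda>i. (Suc i, i)) ` {..<k - 1}"
  let ?C = "{k} \<times> {k - 1..<m - k}"
  \<comment> \<open>If \<open>n = m\<close> is even, the extra vertex lies on the diagonal.\<close>
  let ?D = "if n = 2 * k \<and> n < m then {(k - 1, m - k - 1)} else {}"
  have "slit n m \<subseteq> ?A \<union> ?B \<union> ?C \<union> ?D"
    using k assms by (auto simp: slit_def Let_def k_def[symmetric])
  then have "card (slit n m) \<le> card (?A \<union> ?B \<union> ?C \<union> ?D)"
    by (intro card_mono) auto
  also have "\<dots> \<le> card ?A + card ?B + card ?C + card ?D"
    by (meson add_le_mono card_Un_le le_refl order_trans)
  also have "\<dots> \<le> k + (k - 1) + (m - k - (k - 1)) + (if n = 2 * k \<and> n < m then 1 else 0)"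
    by (intro add_le_mono order_trans[OF card_image_le]) (auto simp: card_cartesian_product)
  also have "\<dots> \<le> 2 * m - n"
    using k assms by auto
  finally show ?thesis .
qed

theorem theorem27:
  fixes n m :: nat
  assumes "0 < n" and "n \<le> m"
  shows "leaky_forcing_number 1 (path_graph n \<box> path_graph m) \<le> 2 * m - n"
proof -
  have "leaky_forcing_number 1 (path_graph n \<box> path_graph m) \<le> card (slit n m)"
    unfolding leaky_forcing_number_def
    by (rule Least_le) (use leaky_forcing_set_slit[OF assms(2)] in blast)
  also have "\<dots> \<le> 2 * m - n"
    using assms by (rule card_slit_le)
  finally show ?thesis .
qed

end
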